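(* Let $\mathcal{X}\subseteq\mathbb{R}^n$ be compact and let $$f(\mathbf{x})=\mathbf{x}^{\mathsf T}\mathsf{A}\mathbf{x}+2\mathbf{a}^{\mathsf T}\mathbf{x}+\max_{\mathbf{u}\in\mathbb{R}^q}\{2\mathbf{u}^{\mathsf T}\mathsf{B}\mathbf{x}+\mathbf{u}^{\mathsf T}\mathsf{C}\mathbf{u}+2\mathbf{c}^{\mathsf T}\mathbf{u}:\mathbf{u}\in\mathcal{U}\},$$ where $\mathcal{U}\subseteq\mathbb{R}^q$ is nonempty, compact and convex, $\mathsf{A}\in\mathcal{S}^n$, $\mathsf{B}\in\mathbb{R}^{q\times n}$, $\mathsf{C}\in\mathcal{S}^q$, $\mathbf{a}\in\mathbb{R}^n$, $\mathbf{c}\in\mathbb{R}^q$. Let $\mathcal{C}\subseteq\mathcal{S}^{n+q+1}$ be a closed convex set with $\mathcal{S}^{n+q+1}_+\supseteq\mathcal{C}\supseteq\mathcal{G}(\mathcal{U}\times\mathcal{X})$, and define for $(\mathbf{x},\mathsf{X})\in\mathbb{R}^n\times\mathcal{S}^n$ $$g(\mathbf{x},\mathsf{X})=\sup_{\Psi,\mathbf{u},\mathsf{U}}\left\{\begin{array}{l}\mathsf{A}\bullet\mathsf{X}+2\mathbf{a}^{\mathsf T}\mathbf{x}+2\mathsf{B}^{\mathsf T}\bullet\Psi+\mathsf{C}\bullet\mathsf{U}+2\mathbf{c}^{\mathsf T}\mathbf{u}\ :\\[2pt] \begin{bmatrix}1&\mathbf{u}^{\mathsf T}&\mathbf{x}^{\mathsf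 T}\\ \mathbf{u}&\mathsf{U}&\Psi^{\mathsf T}\\ \mathbf{x}&\Psi&\mathsf{X}\end{bmatrix}\in\mathcal{C},\ \begin{bmatrix}1&\mathbf{u}^{\mathsf T}\\ \mathbf{u}&\mathsf{U}\end{bmatrix}\in\mathcal{G}(\mathcal{U})\end{array}\right\},$$ where $\Psi\in\mathbb{R}^{n\times q}$, $\mathbf{u}\in\mathbb{R}^q$, $\mathsf{U}\in\mathcal{S}^q$. Let $\bar h:\mathbb{R}^n\times\mathcal{S}^n\to\mathbb{R}$ be a closed concave function. Then $$\inf_{\mathbf{x}\in\mathbb{R}^n}\{\bar h(\mathbf{x},\mathbf{x}\mathbf{x}^{\mathsf T})+f(\mathbf{x}):\mathbf{x}\in\mathcal{X}\}=\inf_{\mathbf{x}\in\mathbb{R}^n,\,\mathsf{X}\in\mathcal{S}^n}\left\{\bar h(\mathbf{x},\mathsf{X})+g(\mathbf{x},\mathsf{X}):\begin{bmatrix}1&\mathbf{x}^{\mathsf T}\\ \mathbf{x}&\mathsf{X}\end{bmatrix}\in\mathcal{G}(\mathcal{X})\right\}.$$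
   Context: $\mathcal{S}^d$ is the space of symmetric $d\times d$ matrices, $\mathcal{S}^d_+$ the cone of positive semidefinite ones, $\mathsf{M}\bullet\mathsf{N}=\operatorname{Tr}(\mathsf{M}^{\mathsf T}\mathsf{N})$. For $\mathcal{F}\subseteq\mathbb{R}^d$, $\mathcal{G}(\mathcal{F})\subseteq\mathcal{S}^{d+1}$ is the closure of the convex hull of $\left\{\begin{bmatrix}1\\ \mathbf{y}\end{bmatrix}\begin{bmatrix}1\\ \mathbf{y}\end{bmatrix}^{\mathsf T}:\mathbf{y}\in\mathcal{F}\right\}$; elements of $\mathcal{U}\times\mathcal{X}$ are vectors $(\mathbf{u}^{\mathsf T},\mathbf{x}^{\mathsf T})^{\mathsf T}\in\mathbb{R}^{q+n}$. The function $g$ is understood as extended-real-valued, with $\sup\emptyset=-\infty$. A proper concave function is closed if it is upper semicontinuous. *)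

theory Defs
  imports "HOL-Analysis.Analysis"
begin

definition Sym :: "(real^'d^'d) set" where
  "Sym = {M. transpose M = M}"

definition PSD :: "(real^'d^'d) set" where
  "PSD = {M \<in> Sym. \<forall>v. 0 \<le> v \<bullet> (M *v v)}"

definition frob :: "real^'n^'m \<Rightarrow> real^'n^'m \<Rightarrow> real"  (infixl "\<bullet>\<^sub>F" 70) where
  "M \<bullet>\<^sub>F N = trace (transpose M ** N)"

definition outer :: "real^'m \<Rightarrow> real^'n \<Rightarrow> real^'n^'m" where
  "outer v w = (\<chi> i j. v$i * w$j)"

text \<open>Sum types index block vectors and block matrices, and \<open>unit\<close> indexes a block of size 1.\<close>

definition stack :: "real^'m \<Rightarrow> real^'n \<Rightarrow> real^('m + 'n)" where
  "stack v w = (\<chi> i. case i of Inl k \<Rightarrow> v$k | Inr k \<Rightarrow> w$k)"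

definition block :: "real^'m^'m \<Rightarrow> real^'n^'m \<Rightarrow> real^'m^'n \<Rightarrow> real^'n^'n
    \<Rightarrow> real^('m + 'n)^('m + 'n)" where
  "block P Q R S = (\<chi> i j.
     case i of
       Inl k \<Rightarrow> (case j of Inl l \<Rightarrow> P$k$l | Inr l \<Rightarrow> Q$k$l)
     | Inr k \<Rightarrow> (case j of Inl l \<Rightarrow> R$k$l | Inr l \<Rightarrow> S$k$l))"

text \<open>The vector \<open>(1, y)\<close>, and the matrix with first row \<open>(1, v\<^sup>T)\<close> and second row \<open>(v, M)\<close>.\<close>

definition lift1 :: "real^'d \<Rightarrow> real^(unit + 'd)" where
  "lift1 y = stack (\<chi> _. 1) y"

definition border :: "real^'d \<Rightarrow> real^'d^'d \<Rightarrow> real^(unit + 'd)^(unit + 'd)" where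
  "border v M = block (\<chi> _ _. 1) (\<chi> _ j. v$j) (\<chi> i _. v$i) M"

text \<open>The closure is taken among all matrices; since \<open>Sym\<close> is closed, this is the closure in \<open>Sym\<close>.\<close>

definition \<G> :: "(real^'d) set \<Rightarrow> (real^(unit + 'd)^(unit + 'd)) set" where
  "\<G> F = closure (convex hull ((\<lambda>y. outer (lift1 y) (lift1 y)) ` F))"

definition stack_set :: "(real^'q) set \<Rightarrow> (real^'n) set \<Rightarrow> (real^('q + 'n)) set" where
  "stack_set U X = {stack u x | u x. u \<in> U \<and> x \<in> X}"

text \<open>\<open>GREATEST\<close> is the maximum of the set, which exists for nonempty compact \<open>U\<close>
  (see \<open>inner_max_attained\<close> below).\<close>

definition f_fun :: "real^'n^'n \<Rightarrow> real^'n^'q \<Rightarrow> real^'q^'q \<Rightarrow> real^'n \<Rightarrow> real^'q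
    \<Rightarrow> (real^'q) set \<Rightarrow> real^'n \<Rightarrow> real" where
  "f_fun A B C a c U x =
     x \<bullet> (A *v x) + 2 * (a \<bullet> x)
     + (GREATEST t. \<exists>u\<in>U. t = 2 * (u \<bullet> (B *v x)) + u \<bullet> (C *v u) + 2 * (c \<bullet> u))"

lemma inner_max_attained:
  fixes B :: "real^'n^'q" and C :: "real^'q^'q" and c :: "real^'q" and x :: "real^'n"
  assumes "compact U" "U \<noteq> {}"
  defines "\<phi> \<equiv> (\<lambda>u. 2 * (u \<bullet> (B *v x)) + u \<bullet> (C *v u) + 2 * (c \<bullet> u))"
  shows "\<exists>u\<in>U. (GREATEST t. \<exists>u\<in>U. t = \<phi> u) = \<phi> u \<and> (\<forall>v\<in>U. \<phi> v \<le> \<phi> u)"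
proof -
  have "continuous_on U \<phi>"
    unfolding \<phi>_def by (intro continuous_intros)
  then obtain u where u: "u \<in> U" "\<forall>v\<in>U. \<phi> v \<le> \<phi> u"
    using continuous_attains_sup[OF assms(1,2)] by blast
  moreover have "(GREATEST t. \<exists>u\<in>U. t = \<phi> u) = \<phi> u"
    by (rule Greatest_equality) (use u in auto)
  ultimately show ?thesis by blast
qed

text \<open>The supremum is taken in the extended reals, so it is \<open>-\<infinity>\<close> when no \<open>(\<Psi>, u, W)\<close> is feasible.
  The rows and columns of the matrix in \<open>K\<close> are ordered as \<open>(1, u, x)\<close>.\<close>

definition g_fun :: "real^'n^'n \<Rightarrow> real^'n^'q \<Rightarrow> real^'q^'q \<Rightarrow> real^'n \<Rightarrow> real^'q
    \<Rightarrow> (real^'q) set \<Rightarrow> (real^(unit + ('q + 'n))^(unit + ('q + 'n))) set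
    \<Rightarrow> real^'n \<Rightarrow> real^'n^'n \<Rightarrow> ereal" where
  "g_fun A B C a c U K x X =
     Sup {ereal (A \<bullet>\<^sub>F X + 2 * (a \<bullet> x) + 2 * (transpose B \<bullet>\<^sub>F \<Psi>) + C \<bullet>\<^sub>F W + 2 * (c \<bullet> u))
          | (\<Psi> :: real^'q^'n) (u :: real^'q) (W :: real^'q^'q).
            W \<in> Sym \<and>
            border (stack u x) (block W (transpose \<Psi>) \<Psi> X) \<in> K \<and>
            border u W \<in> \<G> U}"

definition usc_on :: "'a::topological_space set \<Rightarrow> ('a \<Rightarrow> real) \<Rightarrow> bool" where
  "usc_on S h \<longleftrightarrow> (\<forall>x\<in>S. \<forall>t > h x. \<forall>\<^sub>F y in at x within S. h y < t)"

text \<open>A real-valued function on a nonempty set is proper, so closedness is upper semicontinuity.\<close>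

definition closed_concave_on :: "'a::real_normed_vector set \<Rightarrow> ('a \<Rightarrow> real) \<Rightarrow> bool" where
  "closed_concave_on S h \<longleftrightarrow> concave_on S h \<and> usc_on S h"

end

theory Submission
  imports Defs
begin

text \<open>
  The upper bound on the infimum over \<open>\<G> X\<close> comes from rank-one points \<open>(x, x x\<^sup>T)\<close>. There the
  Schur complement of a positive semidefinite feasible matrix has a vanishing \<open>x\<close>-block, hence
  vanishing off-diagonal blocks, so that \<open>\<Psi> = x u\<^sup>T\<close> (\<open>PSD_border_rank_one\<close>). The objective of
  \<open>g\<close> is then affine in \<open>(u, W)\<close>, and on \<open>\<G> U\<close> an affine function is at most its largest value at
  the points \<open>(u, u u\<^sup>T)\<close> with \<open>u \<in> U\<close>; that value is \<open>f x\<close> (\<open>g_fun_rank_one_le\<close>).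

  For the lower bound, compactness makes every point of \<open>\<G> X\<close> a finite convex combination of
  rank-one points \<open>(x\<^sub>i, x\<^sub>i x\<^sub>i\<^sup>T)\<close>. Choosing \<open>u\<^sub>i\<close> optimal in the definition of \<open>f x\<^sub>i\<close>, the
  same combination of the rank-one matrices of \<open>(1, u\<^sub>i, x\<^sub>i)\<close> lies in \<open>\<G> (U \<times> X) \<subseteq> K\<close> and is
  feasible for \<open>g\<close> with value \<open>\<Sum>i. \<lambda>\<^sub>i f x\<^sub>i\<close>. Concavity of \<open>h\<close> then shows that \<open>h + g\<close> is at least
  a weighted mean of the values \<open>h (x\<^sub>i, x\<^sub>i x\<^sub>i\<^sup>T) + f x\<^sub>i\<close>, hence at least their infimum.
\<close>

section \<open>Outer products and block matrices\<close>

lemma frob_eq_inner: "M \<bullet>\<^sub>F N = M \<bullet> N"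
  unfolding frob_def trace_def matrix_matrix_mult_def transpose_def inner_vec_def
  by simp (rule sum.swap)

lemma inner_outer: "M \<bullet> outer v w = v \<bullet> (M *v w)"
  by (simp add: inner_vec_def outer_def matrix_vector_mult_def sum_distrib_left mult_ac)

lemma inner_axis_matrix_axis: "axis i 1 \<bullet> (M *v axis j 1) = M $ i $ j" for M :: "real^'m^'n"
  by (simp add: inner_axis' matrix_vector_mul_component inner_axis)

lemma transpose_outer [simp]: "transpose (outer v w) = outer w v"
  by (simp add: outer_def transpose_def vec_eq_iff)

lemma outer_self_Sym: "outer v v \<in> Sym"
  by (simp add: Sym_def)

lemma convex_Sym: "convex Sym"
  unfolding convex_def Sym_def by (simp add: transpose_def vec_eq_iff)

lemma outer_lift1: "outer (lift1 y) (lift1 y) = border y (outer y y)"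
  by (auto simp: outer_def lift1_def border_def stack_def block_def vec_eq_iff split: sum.splits)

lemma outer_stack:
  "outer (stack u x) (stack u x) = block (outer u u) (outer u x) (outer x u) (outer x x)"
  by (auto simp: outer_def stack_def block_def vec_eq_iff split: sum.splits)

lemma border_eq_iff: "border v M = border w N \<longleftrightarrow> v = w \<and> M = N"
proof
  assume eq: "border v M = border w N"
  have "v $ i = w $ i" for i
    using arg_cong[OF eq, of "\<lambda>N. N $ Inr i $ Inl ()"] by (simp add: border_def block_def)
  moreover have "M $ i $ j = N $ i $ j" for i j
    using arg_cong[OF eq, of "\<lambda>N. N $ Inr i $ Inr j"] by (simp add: border_def block_def)
  ultimately show "v = w \<and> M = N" by (simp add: vec_eq_iff)
qed simp

lemma border_convex_comb:
  assumes "\<alpha> + \<beta> = 1"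
  shows "\<alpha> *\<^sub>R border v M + \<beta> *\<^sub>R border w N
       = border (\<alpha> *\<^sub>R v + \<beta> *\<^sub>R w) (\<alpha> *\<^sub>R M + \<beta> *\<^sub>R N)"
  using assms by (auto simp: border_def block_def vec_eq_iff split: sum.splits)

lemma stack_lin_comb:
  "\<alpha> *\<^sub>R stack u x + \<beta> *\<^sub>R stack v y = stack (\<alpha> *\<^sub>R u + \<beta> *\<^sub>R v) (\<alpha> *\<^sub>R x + \<beta> *\<^sub>R y)"
  by (auto simp: stack_def vec_eq_iff split: sum.splits)

lemma block_lin_comb:
  "\<alpha> *\<^sub>R block P Q R S + \<beta> *\<^sub>R block P' Q' R' S'
   = block (\<alpha> *\<^sub>R P + \<beta> *\<^sub>R P') (\<alpha> *\<^sub>R Q + \<beta> *\<^sub>R Q') (\<alpha> *\<^sub>R R + \<beta> *\<^sub>R R') (\<alpha> *\<^sub>R S + \<beta> *\<^sub>R S')"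
  by (auto simp: block_def vec_eq_iff split: sum.splits)

lemma transpose_lin_comb:
  "transpose (\<alpha> *\<^sub>R M + \<beta> *\<^sub>R N) = \<alpha> *\<^sub>R transpose M + \<beta> *\<^sub>R transpose N"
  by (simp add: transpose_def vec_eq_iff)

lemma sum_UNIV_Plus: "(\<Sum>i\<in>UNIV. \<phi> i) = (\<Sum>k\<in>UNIV. \<phi> (Inl k)) + (\<Sum>k\<in>UNIV. \<phi> (Inr k))"
  for \<phi> :: "'m::finite + 'n::finite \<Rightarrow> real"
  using sum.Plus[of "UNIV :: 'm set" "UNIV :: 'n set" \<phi>] by simp

lemma inner_stack: "stack u x \<bullet> stack v y = u \<bullet> v + x \<bullet> y"
  by (simp add: inner_vec_def stack_def sum_UNIV_Plus)

lemma block_mult_stack: "block P Q R S *v stack u x = stack (P *v u + Q *v x) (R *v u + S *v x)"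
  by (auto simp: block_def stack_def matrix_vector_mult_def sum_UNIV_Plus vec_eq_iff
      split: sum.splits)

section \<open>Positive semidefinite bordered matrices\<close>

text \<open>This is positive semidefiniteness of the Schur complement \<open>M - v v\<^sup>T\<close>.\<close>

lemma PSD_border_Schur:
  assumes "border v M \<in> PSD"
  shows "(v \<bullet> w)\<^sup>2 \<le> w \<bullet> (M *v w)"
proof -
  let ?s = "(\<chi> _. - (v \<bullet> w)) :: real^unit"
  \<comment> \<open>The first entry \<open>- (v \<bullet> w)\<close> minimises the quadratic form among the vectors that end in \<open>w\<close>.\<close>
  have "0 \<le> stack ?s w \<bullet> (border v M *v stack ?s w)"
    using assms unfolding PSD_def by blast
  also have "\<dots> = w \<bullet> (M *v w) - (v \<bullet> w)\<^sup>2"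
  proof -
    have "(\<chi> _ _. 1) *v ?s = ?s" "(\<chi> _ j. v $ j) *v w = - ?s"
        "(\<chi> i _. v $ i) *v ?s = - (v \<bullet> w) *\<^sub>R v"
      by (simp_all add: matrix_vector_mult_def inner_vec_def vec_eq_iff mult.commute)
    then show ?thesis
      unfolding border_def block_mult_stack inner_stack
      by (simp add: inner_add_right inner_diff_right inner_commute power2_eq_square)
  qed
  finally show ?thesis by simp
qed

text \<open>A positive semidefinite Schur complement with a zero diagonal block has zero blocks beside it:
  otherwise its quadratic form would have a nonzero linear term in a direction without a
  quadratic one and would take negative values.\<close>

lemma PSD_border_rank_one:
  assumes "border (stack u x) (block W (transpose \<Psi>) \<Psi> (outer x x)) \<in> PSD"
  shows "\<Psi> = outer x u"
proof -
  have "\<Psi> $ i $ j = x $ i * u $ j" for i j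
  proof -
    define p where "p = W $ j $ j - (u $ j)\<^sup>2"
    define b where "b = \<Psi> $ i $ j - x $ i * u $ j"
    have form: "0 \<le> p + 2 * s * b" for s
    proof -
      let ?w = "stack (axis j 1) (s *\<^sub>R axis i 1)"
      have "(stack u x \<bullet> ?w)\<^sup>2 \<le> ?w \<bullet> (block W (transpose \<Psi>) \<Psi> (outer x x) *v ?w)"
        by (rule PSD_border_Schur[OF assms])
      also have "stack u x \<bullet> ?w = u $ j + s * x $ i"
        by (simp add: inner_stack inner_axis)
      also have "?w \<bullet> (block W (transpose \<Psi>) \<Psi> (outer x x) *v ?w)
          = W $ j $ j + 2 * s * \<Psi> $ i $ j + s\<^sup>2 * (x $ i)\<^sup>2"
        by (simp add: block_mult_stack inner_stack inner_add_right matrix_vector_mult_scaleR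
            inner_axis_matrix_axis power2_eq_square algebra_simps del: transpose_matrix_vector)
           (simp add: transpose_def outer_def)
      finally show ?thesis
        by (simp add: p_def b_def power2_eq_square algebra_simps)
    qed
    have "b = 0"
    proof (rule ccontr)
      assume "b \<noteq> 0"
      \<comment> \<open>This value of \<open>s\<close> makes \<open>p + 2 * s * b\<close> equal to \<open>-1\<close>.\<close>
      then show False
        using form[of "- (p + 1) / (2 * b)"] by (simp add: field_simps)
    qed
    then show ?thesis by (simp add: b_def)
  qed
  then show ?thesis by (simp add: outer_def vec_eq_iff)
qed

section \<open>The lifted convex hull\<close>

lemma convex_\<G>: "convex (\<G> F)"
  unfolding \<G>_def by (intro convex_closure convex_convex_hull)

lemma rank_one_in_\<G>: "y \<in> F \<Longrightarrow> border y (outer y y) \<in> \<G> F"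
  unfolding \<G>_def outer_lift1[symmetric] by (meson closure_subset hull_inc image_eqI subset_iff)

lemma border_in_\<G>_convex_comb:
  assumes "border v M \<in> \<G> F" "border w N \<in> \<G> F" "0 \<le> \<alpha>" "0 \<le> \<beta>" "\<alpha> + \<beta> = 1"
  shows "border (\<alpha> *\<^sub>R v + \<beta> *\<^sub>R w) (\<alpha> *\<^sub>R M + \<beta> *\<^sub>R N) \<in> \<G> F"
  using convexD[OF convex_\<G> assms] by (simp add: border_convex_comb assms)

lemma \<G>_compact:
  assumes "compact F"
  shows "\<G> F = convex hull ((\<lambda>y. border y (outer y y)) ` F)"
proof -
  have "continuous_on F (\<lambda>y. border y (outer y y) $ i $ j)" for i j
    by (cases i; cases j) (auto simp: border_def block_def outer_def intro!: continuous_intros)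
  then have "continuous_on F (\<lambda>y. \<chi> i j. border y (outer y y) $ i $ j)"
    by (intro continuous_on_vec_lambda)
  then have "continuous_on F (\<lambda>y. border y (outer y y))"
    by simp
  then show ?thesis
    unfolding \<G>_def outer_lift1
    by (intro closure_closed compact_imp_closed compact_convex_hull compact_continuous_image assms)
qed

text \<open>For compact \<open>F\<close> the convex hull is already closed, so a property passes from the
  rank-one points to the whole of \<open>\<G> F\<close> as soon as convex combinations preserve it.\<close>

lemma \<G>_induct [consumes 2, case_names rank_one convex_comb]:
  assumes "compact F" and mem: "border v M \<in> \<G> F"
    and rank_one: "\<And>y. y \<in> F \<Longrightarrow> P y (outer y y)"
    and comb: "\<And>v M w N \<alpha> \<beta>. P v M \<Longrightarrow> P w N \<Longrightarrow> 0 \<le> \<alpha> \<Longrightarrow> 0 \<le> \<beta> \<Longrightarrow> \<alpha> + \<beta> = 1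
      \<Longrightarrow> P (\<alpha> *\<^sub>R v + \<beta> *\<^sub>R w) (\<alpha> *\<^sub>R M + \<beta> *\<^sub>R N)"
  shows "P v M"
proof -
  let ?E = "{border v M | v M. P v M}"
  have "convex ?E"
  proof (rule convexI)
    fix N1 N2 and \<alpha> \<beta> :: real
    assume "N1 \<in> ?E" "N2 \<in> ?E" and ab: "0 \<le> \<alpha>" "0 \<le> \<beta>" "\<alpha> + \<beta> = 1"
    then obtain v M w N
      where "N1 = border v M" "N2 = border w N" "P v M" "P w N" by blast
    with ab show "\<alpha> *\<^sub>R N1 + \<beta> *\<^sub>R N2 \<in> ?E"
      using comb border_convex_comb by blast
  qed
  moreover have "(\<lambda>y. border y (outer y y)) ` F \<subseteq> ?E"
    using rank_one by blast
  ultimately have "\<G> F \<subseteq> ?E"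
    unfolding \<G>_compact[OF \<open>compact F\<close>] by (rule hull_minimal[rotated])
  with mem show ?thesis
    by (auto simp: border_eq_iff)
qed

section \<open>The relaxed objective\<close>

definition relaxed_obj :: "real^'n^'n \<Rightarrow> real^'n^'q \<Rightarrow> real^'q^'q \<Rightarrow> real^'n \<Rightarrow> real^'q
    \<Rightarrow> real^'n \<Rightarrow> real^'n^'n \<Rightarrow> real^'q^'n \<Rightarrow> real^'q \<Rightarrow> real^'q^'q \<Rightarrow> real" where
  "relaxed_obj A B C a c x M \<Psi> u W =
     A \<bullet>\<^sub>F M + 2 * (a \<bullet> x) + 2 * (transpose B \<bullet>\<^sub>F \<Psi>) + C \<bullet>\<^sub>F W + 2 * (c \<bullet> u)"

lemma relaxed_obj_lin_comb:
  "relaxed_obj A B C a c (\<alpha> *\<^sub>R x + \<beta> *\<^sub>R x') (\<alpha> *\<^sub>R M + \<beta> *\<^sub>R M') (\<alpha> *\<^sub>R \<Psi> + \<beta> *\<^sub>R \<Psi>')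
     (\<alpha> *\<^sub>R u + \<beta> *\<^sub>R u') (\<alpha> *\<^sub>R W + \<beta> *\<^sub>R W')
   = \<alpha> * relaxed_obj A B C a c x M \<Psi> u W + \<beta> * relaxed_obj A B C a c x' M' \<Psi>' u' W'"
  by (simp add: relaxed_obj_def frob_eq_inner inner_add_right algebra_simps)

lemma outer_lin_comb_right:
  "outer x (\<alpha> *\<^sub>R u + \<beta> *\<^sub>R v) = \<alpha> *\<^sub>R outer x u + \<beta> *\<^sub>R outer x v"
  by (simp add: outer_def vec_eq_iff algebra_simps)

lemma relaxed_obj_rank_one:
  "relaxed_obj A B C a c x (outer x x) (outer x u) u (outer u u)
   = x \<bullet> (A *v x) + 2 * (a \<bullet> x) + (2 * (u \<bullet> (B *v x)) + u \<bullet> (C *v u) + 2 * (c \<bullet> u))"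
proof -
  have "x \<bullet> (transpose B *v u) = u \<bullet> (B *v x)"
    by (metis dot_lmul_matrix inner_commute transpose_matrix_vector)
  then show ?thesis
    by (simp add: relaxed_obj_def frob_eq_inner inner_outer)
qed

lemma f_fun_attained:
  assumes "compact U" "U \<noteq> {}"
  obtains u where "u \<in> U"
    "f_fun A B C a c U x = relaxed_obj A B C a c x (outer x x) (outer x u) u (outer u u)"
  using inner_max_attained[OF assms, of B x C c]
  unfolding f_fun_def relaxed_obj_rank_one by fastforce

lemma relaxed_obj_rank_one_le_f_fun:
  assumes "compact U" "u \<in> U"
  shows "relaxed_obj A B C a c x (outer x x) (outer x u) u (outer u u) \<le> f_fun A B C a c U x"
  using inner_max_attained[of U B x C c] assms
  unfolding f_fun_def relaxed_obj_rank_one by fastforce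

text \<open>Positive semidefiniteness forces \<open>\<Psi> = outer x u\<close>. The relaxed objective is then affine in
  \<open>(u, W)\<close>, so its bound by \<open>f_fun\<close> extends from rank-one \<open>W\<close> to the lifted hull of \<open>U\<close>.\<close>

lemma g_fun_rank_one_le:
  assumes "compact U" "K \<subseteq> PSD"
  shows "g_fun A B C a c U K x (outer x x) \<le> ereal (f_fun A B C a c U x)"
  unfolding g_fun_def relaxed_obj_def[symmetric]
proof (rule Sup_least, clarify)
  fix \<Psi> u W
  assume inK: "border (stack u x) (block W (transpose \<Psi>) \<Psi> (outer x x)) \<in> K"
    and inG: "border u W \<in> \<G> U"
  have \<Psi>: "\<Psi> = outer x u"
    using inK assms(2) by (intro PSD_border_rank_one) blast
  from \<open>compact U\<close> inG
  have "relaxed_obj A B C a c x (outer x x) (outer x u) u W \<le> f_fun A B C a c U x"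
  proof (induction rule: \<G>_induct)
    case (rank_one u)
    with \<open>compact U\<close> show ?case by (rule relaxed_obj_rank_one_le_f_fun)
  next
    case (convex_comb u W v V \<alpha> \<beta>)
    have "relaxed_obj A B C a c x (outer x x) (outer x (\<alpha> *\<^sub>R u + \<beta> *\<^sub>R v))
          (\<alpha> *\<^sub>R u + \<beta> *\<^sub>R v) (\<alpha> *\<^sub>R W + \<beta> *\<^sub>R V)
        = \<alpha> * relaxed_obj A B C a c x (outer x x) (outer x u) u W
        + \<beta> * relaxed_obj A B C a c x (outer x x) (outer x v) v V"
      using relaxed_obj_lin_comb[of A B C a c \<alpha> x \<beta> x "outer x x" "outer x x"
          "outer x u" "outer x v" u v W V] convex_comb(5)
      by (simp add: outer_lin_comb_right scaleR_add_left[symmetric])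
    also have "\<dots> \<le> f_fun A B C a c U x"
      using convex_comb by (intro convex_bound_le)
    finally show ?case .
  qed
  then show "ereal (relaxed_obj A B C a c x (outer x x) \<Psi> u W) \<le> ereal (f_fun A B C a c U x)"
    by (simp add: \<Psi>)
qed

text \<open>A lower bound for \<open>h + f\<close> on \<open>X\<close> passes to \<open>h + g\<close> on the lifted hull. The induction carries a
  feasible \<open>(\<Psi>, u, W)\<close> as witness: the witness at a rank-one point comes from a maximiser in
  \<open>f_fun\<close>, and witnesses are combined with the same weights as the points.\<close>

lemma le_concave_plus_g_fun:
  assumes "compact X" and U: "compact U" "U \<noteq> {}"
    and K: "\<G> (stack_set U X) \<subseteq> K"
    and h: "concave_on (UNIV \<times> Sym) h"
    and bound: "\<And>x. x \<in> X \<Longrightarrow> m \<le> h (x, outer x x) + f_fun A B C a c U x"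
    and mem: "border x M \<in> \<G> X"
  shows "ereal m \<le> ereal (h (x, M)) + g_fun A B C a c U K x M"
proof -
  let ?obj = "relaxed_obj A B C a c"
  let ?N = "\<lambda>x M \<Psi> u W. border (stack u x) (block W (transpose \<Psi>) \<Psi> M)"
  have "M \<in> Sym \<and> (\<exists>\<Psi> u W. W \<in> Sym \<and> ?N x M \<Psi> u W \<in> \<G> (stack_set U X)
          \<and> border u W \<in> \<G> U \<and> m \<le> h (x, M) + ?obj x M \<Psi> u W)"
    using \<open>compact X\<close> mem
  proof (induction rule: \<G>_induct)
    case (rank_one x)
    obtain u where u: "u \<in> U" and f: "f_fun A B C a c U x = ?obj x (outer x x) (outer x u) u (outer u u)"
      using f_fun_attained[OF U] .
    have "stack u x \<in> stack_set U X"
      using u rank_one by (auto simp: stack_set_def)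
    then have "?N x (outer x x) (outer x u) u (outer u u) \<in> \<G> (stack_set U X)"
      using rank_one_in_\<G>[of "stack u x"] by (simp add: outer_stack)
    moreover have "m \<le> h (x, outer x x) + ?obj x (outer x x) (outer x u) u (outer u u)"
      using bound[OF rank_one] f by simp
    ultimately show ?case
      using rank_one_in_\<G>[OF u] outer_self_Sym[of x] outer_self_Sym[of u] by blast
  next
    case (convex_comb x M x' M' \<alpha> \<beta>)
    note weights = convex_comb(3-5)
    obtain \<Psi> u W where 1: "M \<in> Sym" "W \<in> Sym" "?N x M \<Psi> u W \<in> \<G> (stack_set U X)"
        "border u W \<in> \<G> U" "m \<le> h (x, M) + ?obj x M \<Psi> u W"
      using convex_comb(1) by blast
    obtain \<Psi>' u' W' where 2: "M' \<in> Sym" "W' \<in> Sym" "?N x' M' \<Psi>' u' W' \<in> \<G> (stack_set U X)"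
        "border u' W' \<in> \<G> U" "m \<le> h (x', M') + ?obj x' M' \<Psi>' u' W'"
      using convex_comb(2) by blast
    let ?x = "\<alpha> *\<^sub>R x + \<beta> *\<^sub>R x'" and ?M = "\<alpha> *\<^sub>R M + \<beta> *\<^sub>R M'"
    let ?\<Psi> = "\<alpha> *\<^sub>R \<Psi> + \<beta> *\<^sub>R \<Psi>'" and ?u = "\<alpha> *\<^sub>R u + \<beta> *\<^sub>R u'" and ?W = "\<alpha> *\<^sub>R W + \<beta> *\<^sub>R W'"
    have "?M \<in> Sym" "?W \<in> Sym"
      using 1 2 weights by (auto intro: convexD[OF convex_Sym])
    moreover have "?N ?x ?M ?\<Psi> ?u ?W \<in> \<G> (stack_set U X)"
      using border_in_\<G>_convex_comb[OF 1(3) 2(3) weights]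
      by (simp add: stack_lin_comb block_lin_comb transpose_lin_comb)
    moreover have "border ?u ?W \<in> \<G> U"
      by (rule border_in_\<G>_convex_comb[OF 1(4) 2(4) weights])
    moreover have "m \<le> h (?x, ?M) + ?obj ?x ?M ?\<Psi> ?u ?W"
    proof -
      have "m = \<alpha> * m + \<beta> * m"
        using weights by (simp add: distrib_right[symmetric])
      also have "\<dots> \<le> \<alpha> * (h (x, M) + ?obj x M \<Psi> u W) + \<beta> * (h (x', M') + ?obj x' M' \<Psi>' u' W')"
        using 1(5) 2(5) weights by (intro add_mono mult_left_mono)
      also have "\<dots> = \<alpha> * h (x, M) + \<beta> * h (x', M') + ?obj ?x ?M ?\<Psi> ?u ?W"
        by (simp add: relaxed_obj_lin_comb algebra_simps)
      also have "\<alpha> * h (x, M) + \<beta> * h (x', M') \<le> h (?x, ?M)"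
        using h 1(1) 2(1) weights unfolding concave_on_iff by fastforce
      finally show ?thesis by simp
    qed
    ultimately show ?case by blast
  qed
  then obtain \<Psi> u W where "W \<in> Sym" "?N x M \<Psi> u W \<in> K" "border u W \<in> \<G> U"
      and m: "m \<le> h (x, M) + ?obj x M \<Psi> u W"
    using K by blast
  then have "ereal (?obj x M \<Psi> u W) \<le> g_fun A B C a c U K x M"
    unfolding g_fun_def relaxed_obj_def by (intro Sup_upper) blast
  then have "ereal (h (x, M)) + ereal (?obj x M \<Psi> u W)
      \<le> ereal (h (x, M)) + g_fun A B C a c U K x M"
    by (rule add_left_mono)
  moreover have "ereal m \<le> ereal (h (x, M)) + ereal (?obj x M \<Psi> u W)"
    using m by simp
  ultimately show ?thesis by (rule order_trans[rotated])
qed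

section \<open>Equality of the two infima\<close>

theorem theorem12:
  fixes X :: "(real^'n) set" and U :: "(real^'q) set"
    and A :: "real^'n^'n" and B :: "real^'n^'q" and C :: "real^'q^'q"
    and a :: "real^'n" and c :: "real^'q"
    and K :: "(real^(unit + ('q + 'n))^(unit + ('q + 'n))) set"
    and h :: "(real^'n) \<times> (real^'n^'n) \<Rightarrow> real"
  assumes "compact X"
    and "U \<noteq> {}" and "compact U" and "convex U"
    and "A \<in> Sym" and "C \<in> Sym"
    and "closed K" and "convex K"
    and "K \<subseteq> PSD" and "\<G> (stack_set U X) \<subseteq> K"
    and "closed_concave_on (UNIV \<times> Sym) h"
  shows "(INF x\<in>X. ereal (h (x, outer x x)) + ereal (f_fun A B C a c U x))
       = (INF (x, M) \<in> {(x, M). M \<in> Sym \<and> border x M \<in> \<G> X}.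
            ereal (h (x, M)) + g_fun A B C a c U K x M)"
  (is "?L = ?R")
proof (rule antisym)
  have h: "concave_on (UNIV \<times> Sym) h"
    using assms(11) by (simp add: closed_concave_on_def)
  show "?L \<le> ?R"
  proof (rule INF_greatest, clarify)
    fix x :: "real^'n" and M :: "real^'n^'n"
    assume mem: "border x M \<in> \<G> X"
    show "?L \<le> ereal (h (x, M)) + g_fun A B C a c U K x M"
    proof (rule ccontr)
      assume "\<not> ?thesis"
      \<comment> \<open>A real number strictly between the two sides exists even if one of them is infinite.\<close>
      then have "ereal (h (x, M)) + g_fun A B C a c U K x M < ?L"
        by (simp only: not_le)
      then obtain m where less: "ereal (h (x, M)) + g_fun A B C a c U K x M < ereal m"
          and m: "ereal m < ?L"
        by (blast dest: ereal_dense2)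
      have "m \<le> h (y, outer y y) + f_fun A B C a c U y" if "y \<in> X" for y
        using less_INF_D[OF m that] by simp
      then have "ereal m \<le> ereal (h (x, M)) + g_fun A B C a c U K x M"
        by (intro le_concave_plus_g_fun[OF assms(1,3,2,10) h _ mem])
      with less show False by simp
    qed
  qed
  show "?R \<le> ?L"
  proof (rule INF_greatest)
    fix x assume x: "x \<in> X"
    have "?R \<le> ereal (h (x, outer x x)) + g_fun A B C a c U K x (outer x x)"
      using rank_one_in_\<G>[OF x] outer_self_Sym by (intro INF_lower2[of "(x, outer x x)"]) auto
    also have "\<dots> \<le> ereal (h (x, outer x x)) + ereal (f_fun A B C a c U x)"
      by (intro add_left_mono g_fun_rank_one_le assms)
    finally show "?R \<le> ereal (h (x, outer x x)) + ereal (f_fun A B C a c U x)" .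
  qed
qed

end
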